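(* Let $(X,d)$ be a compact metric space with $\operatorname{diam}(X)\le1$, of Assouad dimension $D<\infty$ and with logarithmic ratio $R=R(X,d)$ satisfying $1<R<\infty$. Suppose that for some $p\in(1,\infty)$ and some $s\in(0,p-1]$ there is a sequence $(\alpha_n)_{n\ge1}\in\mathcal{A}^*_p(X)$ with $\delta(\alpha_{n+1})\le\delta(\alpha_n)^{1+s}$ for all $n\ge 1$. Then for any integer $N>(D+R-1)\bigl[(1+s)(2R-1)-1\bigr]/s$ and any $\varepsilon\in(0,\min\{1,R-1\})$ there is a bi-Hölder embedding $f:X\hookrightarrow\mathbb{R}^N$ such that both $f$ and $f^{-1}:f(X)\to X$ are Hölder of exponent $\dfrac{1}{p(R+\varepsilon)}$.
   Context: A map $f:(X,d)\to(X',d')$ of metric spaces is Hölder of exponent $s>0$ if there is $c>0$ with $d'(f(x_1),f(x_2))\le c\,d(x_1,x_2)^s$ for all $x_1,x_2\in X$. It is a bi-Hölder embedding if it is Hölder of some positive exponent, is injective, and its inverse $f(X)\to X$ is Hölder of some positive exponent. $\mathbb{R}^N$ carries the metric of any norm. Logarithmic ratio. A clopen partition of a compact metric space $(X,d)$ is a finite partition $\alpha=\{A_1,\dots,A_n\}$ of $X$ into nonempty clopen sets. Its diameter is $\delta(\alpha)=\max_i \operatorname{diam}(A_i)$ (and $\delta(\alpha)=0$ if $n=0$). Its gap is $\gamma(\alpha)=\min\{d(x,y): x\in A_i,\ y\in A_j,\ i\ne j\}$ if $n>1$, and $\gamma(\alpha)=\operatorname{diam}(X)$ if $n\le 1$ (with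 $\operatorname{diam}(\emptyset)=0$). Its logarithmic ratio $R(\alpha)\in[0,\infty]$ is $R(\alpha)=\log\gamma(\alpha)/\log\delta(\alpha)$ if $0<\delta(\alpha)<1$ and $\gamma(\alpha)<1$; $R(\alpha)=0$ if $\delta(\alpha)=0$; and $R(\alpha)=+\infty$ if either $0<\delta(\alpha)<1$ and $\gamma(\alpha)\ge 1$, or $\delta(\alpha)\ge 1$. The logarithmic ratio of $(X,d)$ is $$R(X,d)=\lim_{r\to 0^+}\inf\{R(\alpha): \alpha \text{ is a clopen partition of } X \text{ with } \delta(\alpha)<r\}\in[0,\infty],$$ with $\inf\emptyset=+\infty$. The set $\mathcal{A}^*_p(X)$. For $p\in(1,\infty)$, $\mathcal{A}^*_p(X)$ is the set of all sequences $(\alpha_n)_{n\ge1}$ of clopen partitions of $X$ such that: $\lim_{n\to\infty}\delta(\alpha_n)=0$; $\alpha_{n+1}$ is a refinement of $\alpha_n$ for all $n\ge 1$; $\lim_{n\to\infty}R(\alpha_n)=R(X,d)$; and there is $a>0$ with $a\,\delta(\alpha_n)^p\le\delta(\alpha_{n+1})\le\delta(\alpha_n)$ for all $n\ge1$. Assouad dimension. For totally bounded (in particular compact) metric spaces the Assouad dimension coincides with the metric dimension, which is the definition used here: for $0<r_2<r_1$ let $\mathcal{J}(r_1,r_2)$ denote the (maximal) cardinality of a maximal $r_2$-separated set in a closed $r_1$-ball of $X$; then $$\dim_m(X,d)=\lim_{r\to0}\lim_{t\to\infty}\sup\left\{\frac{\log\mathcal{J}(r_1,r_2)}{\log(r_1/r_2)}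 : 0<r_2<r_1<r,\ r_1/r_2>t\right\}.$$ *)

theory Defs
  imports "HOL-Analysis.Analysis" "HOL-Library.Disjoint_Sets"
begin

text \<open>
  A metric space \<open>(X, d)\<close> is a subset \<open>X\<close> of a type of class \<open>metric_space\<close>,
  with \<open>d\<close> the restriction of \<open>dist\<close>.
\<close>

text \<open>
  The two metrics are explicit parameters, because \<open>\<real>\<^sup>N\<close> carries the metric of an arbitrary norm,
  not only the Euclidean one.
\<close>

definition holder_on ::
  "('a \<Rightarrow> 'a \<Rightarrow> real) \<Rightarrow> ('b \<Rightarrow> 'b \<Rightarrow> real) \<Rightarrow> real \<Rightarrow> 'a set \<Rightarrow> ('a \<Rightarrow> 'b) \<Rightarrow> bool" where
  "holder_on d d' s X f \<longleftrightarrow>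
     s > 0 \<and> (\<exists>c>0. \<forall>x1\<in>X. \<forall>x2\<in>X. d' (f x1) (f x2) \<le> c * d x1 x2 powr s)"

definition bi_holder_embedding ::
  "('a \<Rightarrow> 'a \<Rightarrow> real) \<Rightarrow> ('b \<Rightarrow> 'b \<Rightarrow> real) \<Rightarrow> 'a set \<Rightarrow> ('a \<Rightarrow> 'b) \<Rightarrow> bool" where
  "bi_holder_embedding d d' X f \<longleftrightarrow>
     (\<exists>s. holder_on d d' s X f) \<and> inj_on f X \<and>
     (\<exists>s. holder_on d' d s (f ` X) (inv_into X f))"

definition is_norm :: "('b::real_vector \<Rightarrow> real) \<Rightarrow> bool" where
  "is_norm \<nu> \<longleftrightarrow>
     (\<forall>x. \<nu> x \<ge> 0) \<and> (\<forall>x. \<nu> x = 0 \<longleftrightarrow> x = 0) \<and>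
     (\<forall>c x. \<nu> (c *\<^sub>R x) = \<bar>c\<bar> * \<nu> x) \<and> (\<forall>x y. \<nu> (x + y) \<le> \<nu> x + \<nu> y)"

definition norm_dist :: "('b::real_vector \<Rightarrow> real) \<Rightarrow> 'b \<Rightarrow> 'b \<Rightarrow> real" where
  "norm_dist \<nu> x y = \<nu> (x - y)"

definition clopen_partition :: "'a::metric_space set \<Rightarrow> 'a set set \<Rightarrow> bool" where
  "clopen_partition X \<alpha> \<longleftrightarrow>
     finite \<alpha> \<and> partition_on X \<alpha> \<and>
     (\<forall>A\<in>\<alpha>. openin (top_of_set X) A \<and> closedin (top_of_set X) A)"

definition part_diam :: "'a::metric_space set set \<Rightarrow> real" where
  "part_diam \<alpha> = (if \<alpha> = {} then 0 else Max (diameter ` \<alpha>))"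

text \<open>
  For a clopen partition of a compact space with at least two parts the infimum below is attained,
  and hence is the minimum. Note \<open>diameter {} = 0\<close> in the library.
\<close>

definition part_gap :: "'a::metric_space set \<Rightarrow> 'a set set \<Rightarrow> real" where
  "part_gap X \<alpha> =
     (if card \<alpha> > 1 then Inf {dist x y | x y A B. A \<in> \<alpha> \<and> B \<in> \<alpha> \<and> A \<noteq> B \<and> x \<in> A \<and> y \<in> B}
      else diameter X)"

definition part_log_ratio :: "'a::metric_space set \<Rightarrow> 'a set set \<Rightarrow> ereal" where
  "part_log_ratio X \<alpha> =
     (if part_diam \<alpha> = 0 then 0
      else if 0 < part_diam \<alpha> \<and> part_diam \<alpha> < 1 \<and> part_gap X \<alpha> < 1
        then ereal (ln (part_gap X \<alpha>) / ln (part_diam \<alpha>))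
      else \<infinity>)"

text \<open>
  The infimum is monotone in \<open>r\<close>, so the limit exists in the extended reals;
  \<open>Inf {} = \<infinity>\<close> there.
\<close>

definition log_ratio :: "'a::metric_space set \<Rightarrow> ereal" where
  "log_ratio X =
     Lim (at_right (0::real))
       (\<lambda>r. INF \<alpha>\<in>{\<alpha>. clopen_partition X \<alpha> \<and> part_diam \<alpha> < r}. part_log_ratio X \<alpha>)"

text \<open>Sequences are indexed by \<open>n \<ge> 1\<close>; the value at \<open>0\<close> is irrelevant.\<close>

definition A_star :: "real \<Rightarrow> 'a::metric_space set \<Rightarrow> (nat \<Rightarrow> 'a set set) set" where
  "A_star p X =
     {\<alpha>. (\<forall>n\<ge>1. clopen_partition X (\<alpha> n)) \<and>
          (\<lambda>n. part_diam (\<alpha> n)) \<longlonglongrightarrow> 0 \<and>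
          (\<forall>n\<ge>1. refines X (\<alpha> (Suc n)) (\<alpha> n)) \<and>
          (\<lambda>n. part_log_ratio X (\<alpha> n)) \<longlonglongrightarrow> log_ratio X \<and>
          (\<exists>a>0. \<forall>n\<ge>1. a * part_diam (\<alpha> n) powr p \<le> part_diam (\<alpha> (Suc n)) \<and>
                        part_diam (\<alpha> (Suc n)) \<le> part_diam (\<alpha> n))}"

definition separated_set :: "real \<Rightarrow> 'a::metric_space set \<Rightarrow> bool" where
  "separated_set r S \<longleftrightarrow> (\<forall>x\<in>S. \<forall>y\<in>S. x \<noteq> y \<longrightarrow> dist x y \<ge> r)"

definition maximal_separated_in :: "real \<Rightarrow> 'a::metric_space set \<Rightarrow> 'a set \<Rightarrow> bool" where
  "maximal_separated_in r B S \<longleftrightarrow>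
     S \<subseteq> B \<and> separated_set r S \<and> (\<forall>T. S \<subseteq> T \<and> T \<subseteq> B \<and> separated_set r T \<longrightarrow> T = S)"

text \<open>
  If \<open>X\<close> is totally bounded and \<open>r2 > 0\<close>, the \<open>r2\<close>-separated subsets of \<open>X\<close> are finite, of uniformly
  bounded cardinality, so for nonempty \<open>X\<close> the supremum of natural numbers below is a maximum.
\<close>

definition sep_number :: "'a::metric_space set \<Rightarrow> real \<Rightarrow> real \<Rightarrow> nat" where
  "sep_number X r1 r2 = Sup {card S | S x. x \<in> X \<and> maximal_separated_in r2 (cball x r1 \<inter> X) S}"

text \<open>
  The Assouad dimension of a totally bounded space, defined as its metric dimension.
  Both limits are limits of functions that are monotone in \<open>t\<close> and in \<open>r\<close>, respectively.
\<close>

definition assouad_dim :: "'a::metric_space set \<Rightarrow> ereal" where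
  "assouad_dim X =
     Lim (at_right (0::real)) (\<lambda>r. Lim (at_top :: real filter) (\<lambda>t.
       SUP (r1, r2)\<in>{(r1, r2). 0 < r2 \<and> r2 < r1 \<and> r1 < r \<and> r1 / r2 > t}.
         ereal (ln (real (sep_number X r1 r2)) / ln (r1 / r2))))"

end

theory Submission
  imports Defs
begin

text \<open>
  Write \<open>\<delta> n\<close> and \<open>\<gamma> n\<close> for the diameter and the gap of the \<open>n\<close>-th partition and \<open>R' = R + \<epsilon>\<close>, so that
  \<open>\<delta> n powr R' \<le> \<gamma> n\<close> for large \<open>n\<close>. One point from each part of level \<open>n + 1\<close> inside a fixed part of
  level \<open>n\<close> gives a \<open>\<gamma> (n + 1)\<close>-separated set in a ball of radius \<open>\<delta> n\<close>, so there are at most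
  \<open>(\<delta> n / \<delta> (n + 1) powr R') powr D'\<close> such parts for \<open>D' > D\<close>. Since \<open>\<delta> (n + 1) \<le> \<delta> n powr (1 + s)\<close>,
  the bound on \<open>N\<close> makes this at most the number of points of a grid of mesh \<open>\<delta> (n + 1)\<close> in a cube
  of side \<open>\<delta> n / 4\<close>. Mapping the parts injectively to grid points, level by level, yields a map \<open>f\<close>:
  if \<open>x\<close> and \<open>y\<close> are separated for the first time at level \<open>n + 1\<close>, then \<open>dist x y\<close> lies between
  \<open>\<delta> (n + 1) powr R'\<close> and \<open>\<delta> n\<close>, while \<open>f x - f y\<close> has size between \<open>\<delta> (n + 1)\<close> and \<open>\<delta> n\<close> up to
  constants. As \<open>\<delta> (n + 1) \<ge> a * \<delta> n powr p\<close>, both Hoelder estimates follow.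
\<close>

section \<open>Limits of monotone families and the Assouad dimension\<close>

lemma Lim_at_top_antimono:
  fixes f :: "real \<Rightarrow> ereal"
  assumes "antimono f"
  shows "Lim at_top f = (INF t. f t)"
proof (rule tendsto_Lim)
  show "(f \<longlongrightarrow> (INF t. f t)) at_top"
  proof (rule order_tendstoI)
    fix c assume "c < (INF t. f t)"
    then show "\<forall>\<^sub>F t in at_top. c < f t"
      by (intro always_eventually allI) (meson INF_lower UNIV_I less_le_trans)
  next
    fix c assume "(INF t. f t) < c"
    then obtain t0 where "f t0 < c" by (auto simp: INF_less_iff)
    then have "f t < c" if "t \<ge> t0" for t
      using antimonoD[OF assms that] by (rule le_less_trans[rotated])
    then show "\<forall>\<^sub>F t in at_top. f t < c" by (auto simp: eventually_at_top_linorder)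
  qed
qed simp

lemma Lim_at_right_0_mono:
  fixes f :: "real \<Rightarrow> ereal"
  assumes mono: "\<And>x y. 0 < x \<Longrightarrow> x \<le> y \<Longrightarrow> f x \<le> f y"
  shows "Lim (at_right 0) f = (INF r\<in>{0<..}. f r)"
proof (rule tendsto_Lim)
  show "(f \<longlongrightarrow> (INF r\<in>{0<..}. f r)) (at_right 0)"
  proof (rule order_tendstoI)
    fix c assume "c < (INF r\<in>{0<..}. f r)"
    then have "c < f r" if "r > 0" for r
      using that by (meson INF_lower greaterThan_iff less_le_trans)
    then show "\<forall>\<^sub>F r in at_right 0. c < f r"
      by (auto simp: eventually_at_right_field intro: exI[of _ 1])
  next
    fix c assume "(INF r\<in>{0<..}. f r) < c"
    then obtain r0 where "r0 > 0" "f r0 < c" by (auto simp: INF_less_iff)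
    then have "f r < c" if "0 < r" "r < r0" for r
      using mono[of r r0] that by (meson le_less_trans less_imp_le)
    with \<open>r0 > 0\<close> show "\<forall>\<^sub>F r in at_right 0. f r < c"
      by (auto simp: eventually_at_right_field)
  qed
qed simp

text \<open>As \<open>t\<close> grows or \<open>r\<close> shrinks, the set of admissible pairs
  shrinks, so both limits are infima. In this form a strict upper bound on the dimension yields
  concrete thresholds.\<close>

lemma assouad_dim_eq_INF:
  "assouad_dim X = (INF r\<in>{0<..}. INF t.
     SUP (r1, r2)\<in>{(r1, r2). 0 < r2 \<and> r2 < r1 \<and> r1 < r \<and> r1 / r2 > t}.
       ereal (ln (real (sep_number X r1 r2)) / ln (r1 / r2)))"
proof -
  have "Lim at_top (\<lambda>t. SUP (r1, r2)\<in>{(r1, r2). 0 < r2 \<and> r2 < r1 \<and> r1 < r \<and> r1 / r2 > t}.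
            ereal (ln (real (sep_number X r1 r2)) / ln (r1 / r2))) =
          (INF t. SUP (r1, r2)\<in>{(r1, r2). 0 < r2 \<and> r2 < r1 \<and> r1 < r \<and> r1 / r2 > t}.
            ereal (ln (real (sep_number X r1 r2)) / ln (r1 / r2)))" for r :: real
    by (intro Lim_at_top_antimono antimonoI SUP_subset_mono) auto
  then show ?thesis
    unfolding assouad_dim_def
    by (simp only:) (intro Lim_at_right_0_mono INF_mono' SUP_subset_mono, auto)
qed

text \<open>The thresholds witness the strict bound on the infima; the logarithmic quotient is then
  cleared of \<open>ln (r1 / r2)\<close>, positive since \<open>r2 < r1\<close>, and
  exponentiated.\<close>

lemma sep_number_le_powr:
  assumes "assouad_dim X < ereal D"
  obtains r0 t0 where "r0 > 0"
    "\<And>r1 r2. 0 < r2 \<Longrightarrow> r2 < r1 \<Longrightarrow> r1 < r0 \<Longrightarrow> r1 / r2 > t0 \<Longrightarrow>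
       real (sep_number X r1 r2) \<le> max 1 ((r1 / r2) powr D)"
proof -
  obtain r0 t0 where r0: "r0 > 0" and sup:
    "(SUP (r1, r2)\<in>{(r1, r2). 0 < r2 \<and> r2 < r1 \<and> r1 < r0 \<and> r1 / r2 > t0}.
       ereal (ln (real (sep_number X r1 r2)) / ln (r1 / r2))) < ereal D"
    using assms unfolding assouad_dim_eq_INF INF_less_iff by auto
  have "real (sep_number X r1 r2) \<le> max 1 ((r1 / r2) powr D)"
    if r: "0 < r2" "r2 < r1" "r1 < r0" "r1 / r2 > t0" for r1 r2
  proof (cases "sep_number X r1 r2 = 0")
    case False
    have "ereal (ln (real (sep_number X r1 r2)) / ln (r1 / r2)) < ereal D"
      using r by (intro le_less_trans[OF SUP_upper2[of "(r1, r2)"] sup]) auto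
    moreover have "ln (r1 / r2) > 0" using r by simp
    ultimately have "ln (real (sep_number X r1 r2)) < D * ln (r1 / r2)"
      by (simp add: divide_less_eq)
    also have "\<dots> = ln ((r1 / r2) powr D)" using r by (simp add: ln_powr)
    finally have "real (sep_number X r1 r2) \<le> (r1 / r2) powr D" using False r by (subst (asm) ln_less_cancel_iff) auto
    then show ?thesis by simp
  qed simp
  with r0 show thesis by (rule that)
qed

text \<open>Finitely many balls of radius \<open>r / 2\<close> cover \<open>X\<close>, and none
  contains two points of an \<open>r\<close>-separated set.\<close>

lemma card_separated_bounded:
  assumes "compact X" "r > 0"
  obtains M where "\<And>S. S \<subseteq> X \<Longrightarrow> separated_set r S \<Longrightarrow> finite S \<and> card S \<le> M"
proof -
  have "X \<subseteq> (\<Union>c\<in>X. ball c (r / 2))" using assms(2) by auto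
  then obtain C where C: "finite C" "X \<subseteq> (\<Union>c\<in>C. ball c (r / 2))"
    using compactE_image[OF assms(1), of X "\<lambda>c. ball c (r / 2)"] by (metis open_ball)
  have "finite S \<and> card S \<le> card C" if S: "S \<subseteq> X" "separated_set r S" for S
  proof -
    have "\<forall>x\<in>S. \<exists>c\<in>C. dist c x < r / 2"
    proof
      fix x assume "x \<in> S"
      with C S have "x \<in> (\<Union>c\<in>C. ball c (r / 2))" by blast
      then show "\<exists>c\<in>C. dist c x < r / 2" by simp
    qed
    then obtain h where h: "\<And>x. x \<in> S \<Longrightarrow> h x \<in> C \<and> dist (h x) x < r / 2" by metis
    have "inj_on h S"
    proof (rule inj_onI, rule ccontr)
      fix x y assume xy: "x \<in> S" "y \<in> S" "h x = h y" "x \<noteq> y"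
      have "dist x y < r" using h[OF xy(1)] h[OF xy(2)] xy(3) by (metis dist_triangle_half_r)
      moreover have "dist x y \<ge> r" using S xy by (auto simp: separated_set_def)
      ultimately show False by simp
    qed
    moreover have "h ` S \<subseteq> C" using h by auto
    ultimately show ?thesis using C(1) by (meson card_inj_on_le finite_subset finite_imageD)
  qed
  then show thesis by (rule that)
qed

text \<open>\<open>sep_number\<close> sees only maximal separated sets, so \<open>T\<close> is
  enlarged to a separated set of largest cardinality, which is maximal. The uniform bound
  \<open>M\<close> provides this set and also makes the supremum of naturals an upper bound.\<close>

lemma card_le_sep_number:
  assumes X: "compact X" and r: "r2 > 0" and x: "x \<in> X"
    and T: "T \<subseteq> cball x r1 \<inter> X" "separated_set r2 T"
  shows "card T \<le> sep_number X r1 r2"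
proof -
  obtain M where M: "\<And>S. S \<subseteq> X \<Longrightarrow> separated_set r2 S \<Longrightarrow> finite S \<and> card S \<le> M"
    using card_separated_bounded[OF X r] by blast
  let ?P = "\<lambda>S. T \<subseteq> S \<and> S \<subseteq> cball x r1 \<inter> X \<and> separated_set r2 S"
  obtain S where S: "?P S" and max: "\<And>U. ?P U \<Longrightarrow> card U \<le> card S"
  proof -
    have "?P T" using T by simp
    moreover have "\<forall>U. ?P U \<longrightarrow> card U < Suc M" using M by (auto simp: less_Suc_eq_le)
    ultimately have "\<exists>S. ?P S \<and> (\<forall>U. ?P U \<longrightarrow> card U \<le> card S)"
      by (rule Lattices_Big.ex_has_greatest_nat)
    then show thesis using that by blast
  qed
  have "maximal_separated_in r2 (cball x r1 \<inter> X) S"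
    unfolding maximal_separated_in_def
  proof (intro conjI allI impI)
    fix U assume U: "S \<subseteq> U \<and> U \<subseteq> cball x r1 \<inter> X \<and> separated_set r2 U"
    then have "card U \<le> card S" using S by (intro max) auto
    moreover have "finite U" using U M by auto
    ultimately show "U = S" using U by (metis card_seteq)
  qed (use S in auto)
  then have "card S \<in> {card S |S x. x \<in> X \<and> maximal_separated_in r2 (cball x r1 \<inter> X) S}"
    using x by auto
  moreover have "bdd_above {card S |S x. x \<in> X \<and> maximal_separated_in r2 (cball x r1 \<inter> X) S}"
    using M by (intro bdd_aboveI[of _ M]) (auto simp: maximal_separated_in_def)
  ultimately have "card S \<le> sep_number X r1 r2"
    unfolding sep_number_def by (rule cSup_upper)
  moreover have "card T \<le> card S" using S M by (intro card_mono) auto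
  ultimately show ?thesis by simp
qed

section \<open>Gaps, diameters and parts of clopen partitions\<close>

lemma part_gap_nonneg:
  assumes "bounded X" "{} \<notin> \<alpha>"
  shows "part_gap X \<alpha> \<ge> 0"
proof (cases "card \<alpha> > 1")
  case True
  then have "\<alpha> \<noteq> {}" by auto
  then obtain A where "A \<in> \<alpha>" by blast
  moreover have "\<alpha> \<noteq> {A}" using True by auto
  ultimately obtain B where "B \<in> \<alpha>" "A \<noteq> B" by blast
  moreover obtain x y where "x \<in> A" "y \<in> B"
    using assms \<open>A \<in> \<alpha>\<close> \<open>B \<in> \<alpha>\<close> by (metis ex_in_conv)
  \<comment> \<open>A lower bound for \<open>Inf\<close> on the reals presupposes a nonempty set;
    points of two distinct parts supply an element.\<close>
  ultimately have ne: "{dist x y |x y A B. A \<in> \<alpha> \<and> B \<in> \<alpha> \<and> A \<noteq> B \<and> x \<in> A \<and> y \<in> B} \<noteq> {}"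
    using \<open>A \<in> \<alpha>\<close> by blast
  have "0 \<le> Inf {dist x y |x y A B. A \<in> \<alpha> \<and> B \<in> \<alpha> \<and> A \<noteq> B \<and> x \<in> A \<and> y \<in> B}"
    using ne by (rule cInf_greatest) auto
  then show ?thesis using True by (simp add: part_gap_def)
next
  case False
  then show ?thesis using assms diameter_ge_0[of X] by (simp add: part_gap_def)
qed

lemma part_gap_le_dist:
  assumes "finite \<alpha>" "A \<in> \<alpha>" "B \<in> \<alpha>" "A \<noteq> B" "x \<in> A" "y \<in> B"
  shows "part_gap X \<alpha> \<le> dist x y"
proof -
  have "card \<alpha> > 1"
    using assms card_mono[of \<alpha> "{A, B}"] by simp
  moreover have "bdd_below {dist x y |x y A B. A \<in> \<alpha> \<and> B \<in> \<alpha> \<and> A \<noteq> B \<and> x \<in> A \<and> y \<in> B}"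
    by (rule bdd_belowI[of _ 0]) auto
  ultimately show ?thesis
    unfolding part_gap_def using assms by (simp only: if_True) (rule cInf_lower, blast, assumption)
qed

lemma dist_le_part_diam:
  assumes "bounded X" "clopen_partition X \<alpha>" "A \<in> \<alpha>" "x \<in> A" "y \<in> A"
  shows "dist x y \<le> part_diam \<alpha>"
proof -
  have "A \<subseteq> X" using assms by (auto simp: clopen_partition_def partition_on_def)
  then have "dist x y \<le> diameter A"
    using assms by (intro diameter_bounded_bound) (auto intro: bounded_subset)
  also have "\<dots> \<le> part_diam \<alpha>"
    using assms by (auto simp: part_diam_def clopen_partition_def intro!: Max_ge)
  finally show ?thesis .
qed

lemma part_diam_nonneg:
  assumes "bounded X" "clopen_partition X \<alpha>"
  shows "part_diam \<alpha> \<ge> 0"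
proof (cases "\<alpha> = {}")
  case False
  then obtain A where "A \<in> \<alpha>" by blast
  moreover from this obtain x where "x \<in> A"
    using assms by (fastforce simp: clopen_partition_def partition_on_def)
  ultimately show ?thesis using dist_le_part_diam[OF assms, of A x x] by simp
qed (simp add: part_diam_def)

definition part_of :: "'a set set \<Rightarrow> 'a \<Rightarrow> 'a set" where
  "part_of \<alpha> x = (THE A. A \<in> \<alpha> \<and> x \<in> A)"

lemma part_of:
  assumes "partition_on X \<alpha>" "x \<in> X"
  shows "part_of \<alpha> x \<in> \<alpha>" "x \<in> part_of \<alpha> x"
proof -
  have "\<exists>!A. A \<in> \<alpha> \<and> x \<in> A"
    using assms by (auto simp: partition_on_def disjoint_def)
  then show "part_of \<alpha> x \<in> \<alpha>" "x \<in> part_of \<alpha> x"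
    unfolding part_of_def by (auto dest!: theI')
qed

text \<open>Choose one point of \<open>Y\<close> in each part that \<open>Y\<close> meets: points of
  distinct parts are at least the gap apart, so the chosen set \<open>T\<close> is
  \<open>r2\<close>-separated.\<close>

lemma card_parts_le_sep_number:
  assumes X: "compact X" and r: "r2 > 0"
    and fin: "finite \<beta>" and part: "partition_on X \<beta>" and gap: "part_gap X \<beta> \<ge> r2"
    and x: "x \<in> X" and Y: "Y \<subseteq> cball x r1 \<inter> X"
  shows "card (part_of \<beta> ` Y) \<le> sep_number X r1 r2"
proof -
  obtain T where T: "T \<subseteq> Y" "inj_on (part_of \<beta>) T" "part_of \<beta> ` T = part_of \<beta> ` Y"
    by (metis subset_image_inj order_refl)
  have "separated_set r2 T"
    unfolding separated_set_def
  proof (intro ballI impI)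
    fix u v assume uv: "u \<in> T" "v \<in> T" "u \<noteq> v"
    then have "u \<in> X" "v \<in> X" using T Y by auto
    moreover have "part_of \<beta> u \<noteq> part_of \<beta> v" using T uv by (auto dest: inj_onD)
    ultimately have "part_gap X \<beta> \<le> dist u v"
      using part_of[OF part] fin by (intro part_gap_le_dist)
    with gap show "dist u v \<ge> r2" by simp
  qed
  then have "card T \<le> sep_number X r1 r2"
    using T Y by (intro card_le_sep_number[OF X r x]) auto
  then show ?thesis using T by (metis card_image)
qed

section \<open>Mixed-radix expansions\<close>

definition positional :: "(nat \<Rightarrow> real) \<Rightarrow> (nat \<Rightarrow> nat) \<Rightarrow> real" where
  "positional w a = (\<Sum>m. w m * real (a m))"

text \<open>\<open>K m\<close> is the number of digits allowed at place \<open>m\<close>. By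
  \<open>base_le\<close> the whole digit range of a place spans at most a quarter of one unit of the
  preceding place, so later digits cannot compensate an earlier difference.\<close>

locale positional_system =
  fixes w :: "nat \<Rightarrow> real" and K :: "nat \<Rightarrow> nat"
  assumes w_pos: "w m > 0"
    and base_pos: "K m > 0"
    and base_le: "real (K (Suc m)) * w (Suc m) \<le> w m / 4"
begin

lemma base_decay: "real (K (n + k)) * w (n + k) \<le> real (K n) * w n * (1/4) ^ k"
proof (induction k)
  case (Suc k)
  have "real (K (n + Suc k)) * w (n + Suc k) \<le> w (n + k) / 4" using base_le[of "n + k"] by simp
  \<comment> \<open>Since \<open>K (n + k) >= 1\<close>, a weight is at most the span of its digit
    range, and spans decay by a factor of 4.\<close>
  also have "\<dots> \<le> real (K (n + k)) * w (n + k) / 4"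
    using base_pos[of "n + k"] w_pos[of "n + k"] by (simp add: Suc_leI)
  finally show ?case using Suc by simp
qed simp

lemma summable_digits:
  assumes "\<And>m. a m < K m"
  shows "summable (\<lambda>m. w m * real (a m))"
proof (rule summable_comparison_test)
  show "summable (\<lambda>m. real (K 0) * w 0 * (1/4::real) ^ m)"
    by (intro summable_mult summable_geometric) simp
  have "norm (w m * real (a m)) \<le> real (K 0) * w 0 * (1/4) ^ m" for m
  proof -
    have "norm (w m * real (a m)) \<le> real (K m) * w m"
      using w_pos[of m] assms[of m] by (simp add: mult.commute)
    also have "\<dots> \<le> real (K 0) * w 0 * (1/4) ^ m" using base_decay[of 0 m] by simp
    finally show ?thesis .
  qed
  then show "\<exists>N. \<forall>m\<ge>N. norm (w m * real (a m)) \<le> real (K 0) * w 0 * (1/4) ^ m" by blast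
qed

text \<open>The places below \<open>n\<close> cancel; the remaining terms are dominated by a
  geometric series of ratio 1/4, whose sum factor 4/3 is rounded up to 2.\<close>

lemma positional_diff_le:
  assumes a: "\<And>m. a m < K m" and b: "\<And>m. b m < K m"
    and eq: "\<And>m. m < n \<Longrightarrow> a m = b m"
  shows "\<bar>positional w a - positional w b\<bar> \<le> 2 * (real (K n) * w n)"
proof -
  define g where "g m = w m * real (a m) - w m * real (b m)" for m
  have g: "summable g" unfolding g_def by (intro summable_diff summable_digits a b)
  have "positional w a - positional w b = suminf g"
    unfolding positional_def g_def by (intro suminf_diff summable_digits a b)
  also have "\<dots> = (\<Sum>k. g (k + n)) + (\<Sum>k<n. g k)" by (rule suminf_split_initial_segment[OF g])
  also have "(\<Sum>k<n. g k) = 0" by (auto simp: g_def eq)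
  finally have "\<bar>positional w a - positional w b\<bar> = norm (\<Sum>k. g (k + n))" by simp
  also have "\<dots> \<le> (\<Sum>k. real (K n) * w n * (1/4) ^ k)"
  proof (rule norm_suminf_le)
    fix k
    have "norm (g (k + n)) = w (k + n) * \<bar>real (a (k + n)) - real (b (k + n))\<bar>"
      using w_pos[of "k + n"] by (simp add: g_def abs_mult flip: right_diff_distrib)
    also have "\<dots> \<le> w (k + n) * real (K (k + n))"
      using w_pos[of "k + n"] a[of "k + n"] b[of "k + n"] by (intro mult_left_mono) auto
    also have "\<dots> \<le> real (K n) * w n * (1/4) ^ k"
      using base_decay[of n k] by (simp add: add.commute mult.commute)
    finally show "norm (g (k + n)) \<le> real (K n) * w n * (1/4) ^ k" .
  qed (intro summable_mult summable_geometric, simp)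
  also have "\<dots> = real (K n) * w n * (4/3)"
    by (subst suminf_mult) (auto simp: suminf_geometric intro: summable_geometric)
  also have "\<dots> \<le> 2 * (real (K n) * w n)" using w_pos[of n] by simp
  finally show ?thesis .
qed

text \<open>Pass through the digit sequence \<open>c\<close>, which is \<open>a\<close> with its
  digit at \<open>n\<close> replaced by that of \<open>b\<close>. The change costs at least
  \<open>w n\<close>, while \<open>c\<close> and \<open>b\<close> agree up to and including
  \<open>n\<close> and so differ by at most half of that.\<close>

lemma positional_diff_ge:
  assumes a: "\<And>m. a m < K m" and b: "\<And>m. b m < K m"
    and eq: "\<And>m. m < n \<Longrightarrow> a m = b m" and neq: "a n \<noteq> b n"
  shows "\<bar>positional w a - positional w b\<bar> \<ge> w n / 2"
proof -
  define c where "c = a(n := b n)"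
  have c: "c m < K m" for m using a b by (simp add: c_def)
  have "positional w a - positional w c = (\<Sum>m. w m * real (a m) - w m * real (c m))"
    unfolding positional_def by (intro suminf_diff summable_digits a c)
  also have "\<dots> = (\<Sum>m\<in>{n}. w m * real (a m) - w m * real (c m))"
    by (rule suminf_finite) (auto simp: c_def)
  also have "\<dots> = w n * (real (a n) - real (b n))" by (simp add: c_def algebra_simps)
  finally have "\<bar>positional w a - positional w c\<bar> = w n * \<bar>real (a n) - real (b n)\<bar>"
    using w_pos[of n] by (simp add: abs_mult)
  moreover have "1 \<le> \<bar>real (a n) - real (b n)\<bar>" using neq by linarith
  ultimately have "\<bar>positional w a - positional w c\<bar> \<ge> w n"
    using w_pos[of n] by simp
  moreover have "\<bar>positional w c - positional w b\<bar> \<le> 2 * (real (K (Suc n)) * w (Suc n))"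
    using c b by (rule positional_diff_le) (auto simp: c_def eq less_Suc_eq)
  ultimately show ?thesis using base_le[of n] by linarith
qed

end

section \<open>Comparison of an arbitrary norm with coordinates and the Euclidean norm\<close>

lemma is_norm_le:
  fixes \<nu> :: "real ^ 'n \<Rightarrow> real"
  assumes "is_norm \<nu>"
  obtains C where "C > 0" "\<And>v. \<nu> v \<le> C * (\<Sum>i\<in>UNIV. \<bar>v $ i\<bar>)"
proof -
  have sub: "\<nu> (sum g A) \<le> (\<Sum>i\<in>A. \<nu> (g i))" if "finite A" for g :: "'n \<Rightarrow> real ^ 'n" and A
    using that
  proof induction
    case (insert i A)
    have "\<nu> (g i + sum g A) \<le> \<nu> (g i) + \<nu> (sum g A)" using assms by (simp add: is_norm_def)
    then show ?case using insert by simp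
  next
    case empty
    have "\<nu> 0 = 0" using assms unfolding is_norm_def by blast
    then show ?case by simp
  qed
  define C where "C = 1 + (\<Sum>i\<in>UNIV. \<nu> (axis i 1 :: real ^ 'n))"
  have nn: "\<nu> v \<ge> 0" for v using assms by (simp add: is_norm_def)
  have "\<nu> v \<le> C * (\<Sum>i\<in>UNIV. \<bar>v $ i\<bar>)" for v
  proof -
    have "\<nu> v = \<nu> (\<Sum>i\<in>UNIV. v $ i *\<^sub>R axis i 1)"
      by (simp add: basis_expansion flip: scalar_mult_eq_scaleR)
    also have "\<dots> \<le> (\<Sum>i\<in>UNIV. \<nu> (v $ i *\<^sub>R axis i 1))" by (rule sub) simp
    also have "\<dots> = (\<Sum>i\<in>UNIV. \<bar>v $ i\<bar> * \<nu> (axis i 1))" using assms by (simp add: is_norm_def)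
    also have "\<dots> \<le> (\<Sum>i\<in>UNIV. \<bar>v $ i\<bar> * C)"
    proof (intro sum_mono mult_left_mono)
      fix i
      have "\<nu> (axis i 1) \<le> (\<Sum>i\<in>UNIV. \<nu> (axis i 1 :: real ^ 'n))"
        by (rule member_le_sum) (auto simp: nn)
      then show "\<nu> (axis i 1) \<le> C" by (simp add: C_def)
    qed simp
    finally show ?thesis by (simp add: sum_distrib_left mult.commute)
  qed
  moreover have "C > 0" unfolding C_def by (intro add_pos_nonneg sum_nonneg nn) simp
  ultimately show thesis using that by blast
qed

text \<open>By the upper bound \<open>\<nu>\<close> is Lipschitz, so it attains a minimum on the
  compact unit sphere. This minimum is positive, and homogeneity extends the bound to all
  vectors.\<close>

lemma is_norm_ge:
  fixes \<nu> :: "real ^ 'n \<Rightarrow> real"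
  assumes "is_norm \<nu>"
  obtains c where "c > 0" "\<And>v. \<nu> v \<ge> c * norm v"
proof -
  obtain C where C: "C > 0" "\<And>v. \<nu> v \<le> C * (\<Sum>i\<in>UNIV. \<bar>v $ i\<bar>)"
    using is_norm_le[OF assms] by blast
  have C': "\<nu> v \<le> C * real CARD('n) * norm v" for v
  proof -
    have "(\<Sum>i\<in>UNIV. \<bar>v $ i\<bar>) \<le> real CARD('n) * norm v"
      by (rule sum_bounded_above) (simp add: component_le_norm_cart)
    then have "C * (\<Sum>i\<in>UNIV. \<bar>v $ i\<bar>) \<le> C * (real CARD('n) * norm v)" using C(1) by simp
    with C(2)[of v] show ?thesis by (simp add: mult.assoc)
  qed
  have tri: "\<nu> x - \<nu> y \<le> \<nu> (x - y)" for x y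
  proof -
    have "\<nu> ((x - y) + y) \<le> \<nu> (x - y) + \<nu> y" using assms unfolding is_norm_def by blast
    then show ?thesis by simp
  qed
  have "(C * real CARD('n))-lipschitz_on (sphere 0 1) \<nu>"
  proof (rule lipschitz_onI)
    fix x y :: "real ^ 'n"
    have "\<nu> x - \<nu> y \<le> C * real CARD('n) * norm (x - y)"
      using tri[of x y] C'[of "x - y"] by linarith
    moreover have "\<nu> y - \<nu> x \<le> C * real CARD('n) * norm (x - y)"
      using tri[of y x] C'[of "y - x"] by (simp add: norm_minus_commute)
    ultimately show "dist (\<nu> x) (\<nu> y) \<le> C * real CARD('n) * dist x y"
      by (simp add: dist_norm abs_le_iff)
  qed (use C in simp)
  then have "continuous_on (sphere 0 1) \<nu>" by (rule lipschitz_on_continuous_on)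
  moreover have "sphere (0 :: real ^ 'n) 1 \<noteq> {}"
    using norm_axis_1 by (metis mem_sphere_0 empty_iff)
  ultimately obtain u where u: "norm u = 1" "\<And>v. norm v = 1 \<Longrightarrow> \<nu> u \<le> \<nu> v"
    using continuous_attains_inf[of "sphere (0 :: real ^ 'n) 1" \<nu>] by auto
  have "\<nu> u * norm v \<le> \<nu> v" for v
  proof (cases "v = 0")
    case True
    then show ?thesis using assms by (simp add: is_norm_def)
  next
    case False
    then have "\<nu> u \<le> \<nu> ((1 / norm v) *\<^sub>R v)" by (intro u) simp
    also have "\<dots> = 1 / norm v * \<nu> v" using assms by (simp add: is_norm_def)
    finally show ?thesis using False by (simp add: field_simps)
  qed
  moreover have "\<nu> u > 0"
    using assms u(1) unfolding is_norm_def by (metis less_eq_real_def norm_zero zero_neq_one)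
  ultimately show thesis using that by blast
qed

section \<open>From labels to a bi-Hoelder map\<close>

text \<open>
  The labels \<open>q n x\<close> play the role of the part of level \<open>n\<close> containing \<open>x\<close>; the partitions need not
  refine each other, since only points with equal labels below \<open>n\<close> are compared.
\<close>

lemma bi_holder_from_labels:
  fixes X :: "'a::metric_space set" and q :: "nat \<Rightarrow> 'a \<Rightarrow> 'b" and \<nu> :: "real ^ 'n \<Rightarrow> real"
  assumes "positional_system w K" and \<nu>: "is_norm \<nu>" and \<theta>: "\<theta> > 0" and C: "C > 0"
    and fin: "\<And>n x. x \<in> X \<Longrightarrow> finite (q n ` {y \<in> X. \<forall>m<n. q m y = q m x})"
    and card: "\<And>n x. x \<in> X \<Longrightarrow> card (q n ` {y \<in> X. \<forall>m<n. q m y = q m x}) \<le> K n ^ CARD('n)"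
    and sep: "\<And>x y. x \<in> X \<Longrightarrow> y \<in> X \<Longrightarrow> x \<noteq> y \<Longrightarrow> \<exists>n. q n x \<noteq> q n y"
    and dist_ge: "\<And>n x y. x \<in> X \<Longrightarrow> y \<in> X \<Longrightarrow> \<forall>m<n. q m x = q m y \<Longrightarrow> q n x \<noteq> q n y \<Longrightarrow>
                    real (K n) * w n \<le> C * dist x y powr \<theta>"
    and dist_le: "\<And>n x y. x \<in> X \<Longrightarrow> y \<in> X \<Longrightarrow> \<forall>m<n. q m x = q m y \<Longrightarrow> q n x \<noteq> q n y \<Longrightarrow>
                    dist x y \<le> C * w n powr \<theta>"
  shows "\<exists>f :: 'a \<Rightarrow> real ^ 'n.
           bi_holder_embedding dist (norm_dist \<nu>) X f \<and>
           holder_on dist (norm_dist \<nu>) \<theta> X f \<and>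
           holder_on (norm_dist \<nu>) dist \<theta> (f ` X) (inv_into X f)"
proof -
  interpret positional_system w K by fact
  define S where "S n x = q n ` {y \<in> X. \<forall>m<n. q m y = q m x}" for n x
  \<comment> \<open>The injection into digit vectors depends on the set of available labels and not
    on the point, so points with the same earlier labels use the same code.\<close>
  define code :: "nat \<Rightarrow> 'b set \<Rightarrow> 'b \<Rightarrow> 'n \<Rightarrow> nat" where
    "code n A = (SOME h. h ` A \<subseteq> UNIV \<rightarrow> {..<K n} \<and> inj_on h A)" for n A
  \<comment> \<open>Outside \<open>X\<close> the digits are 0, so the digit bound
    \<open>e_less\<close> holds for every point.\<close>
  define e where "e n x = (if x \<in> X then code n (S n x) (q n x) else (\<lambda>_. 0))" for n x
  define f :: "'a \<Rightarrow> real ^ 'n" where "f x = (\<chi> i. positional w (\<lambda>m. e m x i))" for x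
  have code: "code n (S n x) ` S n x \<subseteq> UNIV \<rightarrow> {..<K n} \<and> inj_on (code n (S n x)) (S n x)"
    if "x \<in> X" for n x
  proof -
    have "card (UNIV \<rightarrow> {..<K n} :: ('n \<Rightarrow> nat) set) = K n ^ CARD('n)"
      using card_PiE[of "UNIV :: 'n set" "\<lambda>_. {..<K n}"] by (simp add: PiE_UNIV_domain)
    moreover have "finite (UNIV \<rightarrow> {..<K n} :: ('n \<Rightarrow> nat) set)"
      using finite_PiE[of "UNIV :: 'n set" "\<lambda>_. {..<K n}"] by (simp add: PiE_UNIV_domain)
    ultimately have "\<exists>h. h ` S n x \<subseteq> (UNIV \<rightarrow> {..<K n} :: ('n \<Rightarrow> nat) set) \<and> inj_on h (S n x)"
      using card_le_inj[of "S n x" "UNIV \<rightarrow> {..<K n} :: ('n \<Rightarrow> nat) set"] fin[OF that] card[OF that]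
      by (simp add: S_def)
    then show ?thesis unfolding code_def by (rule someI_ex)
  qed
  have q_S: "q n x \<in> S n x" if "x \<in> X" for n x using that by (auto simp: S_def)
  have e_less: "e m x i < K m" for m x i
  proof (cases "x \<in> X")
    case True
    have "code m (S m x) (q m x) \<in> UNIV \<rightarrow> {..<K m}"
      using code[OF True, of m] q_S[OF True, of m] by blast
    then show ?thesis using True by (auto simp: e_def Pi_def)
  qed (simp add: e_def base_pos)
  have S_eq: "S m x = S m y" if "\<forall>k<m. q k x = q k y" for m x y
    using that by (auto simp: S_def)
  obtain C1 where C1: "C1 > 0" "\<And>v. \<nu> v \<le> C1 * (\<Sum>i\<in>UNIV. \<bar>v $ i\<bar>)"
    using is_norm_le[OF \<nu>] by blast
  obtain c2 where c2: "c2 > 0" "\<And>v. \<nu> v \<ge> c2 * norm v"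
    using is_norm_ge[OF \<nu>] by blast
  define A where "A = C1 * (real CARD('n) * (2 * C))"
  define B where "B = C * (2 / c2) powr \<theta>"
  have AB: "A > 0" "B > 0" unfolding A_def B_def using C C1 c2 by auto
  have main: "\<nu> (f x - f y) \<le> A * dist x y powr \<theta> \<and> dist x y \<le> B * \<nu> (f x - f y) powr \<theta>"
    if xy: "x \<in> X" "y \<in> X" "x \<noteq> y" for x y
  proof -
    \<comment> \<open>At the first level where the labels differ, all earlier digit vectors agree,
      and injectivity of the common code gives a coordinate \<open>i\<close> whose digits differ.
      The upper estimate sums all coordinates; the lower one uses only \<open>i\<close>.\<close>
    define n where "n = (LEAST n. q n x \<noteq> q n y)"
    have neq: "q n x \<noteq> q n y" unfolding n_def using sep[OF xy] by (rule LeastI_ex)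
    have eq: "\<forall>m<n. q m x = q m y" unfolding n_def using not_less_Least by blast
    have e_eq: "e m x = e m y" if "m < n" for m
      using eq that S_eq[of m x y] xy by (simp add: e_def)
    have S_n: "S n x = S n y" by (rule S_eq) (rule eq)
    have "code n (S n x) (q n x) \<noteq> code n (S n x) (q n y)"
      using code[OF xy(1), of n] q_S[OF xy(1), of n] q_S[OF xy(2), of n] neq S_n
      by (metis inj_on_contraD)
    then have "e n x \<noteq> e n y" using S_n xy by (simp add: e_def)
    then obtain i where i: "e n x i \<noteq> e n y i" by blast
    have "\<nu> (f x - f y) \<le> C1 * (\<Sum>i\<in>UNIV. \<bar>(f x - f y) $ i\<bar>)" by (rule C1)
    also have "\<dots> \<le> C1 * (real CARD('n) * (2 * (real (K n) * w n)))"
      using C1(1) by (intro mult_left_mono sum_bounded_above)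
        (auto simp: f_def e_eq intro!: positional_diff_le e_less)
    also have "\<dots> \<le> C1 * (real CARD('n) * (2 * (C * dist x y powr \<theta>)))"
      using C1(1) dist_ge[OF xy(1,2) eq neq] by (intro mult_left_mono) auto
    finally have 1: "\<nu> (f x - f y) \<le> A * dist x y powr \<theta>" by (simp add: A_def mult_ac)
    have "w n / 2 \<le> \<bar>positional w (\<lambda>m. e m x i) - positional w (\<lambda>m. e m y i)\<bar>"
      by (rule positional_diff_ge) (simp_all add: e_less e_eq i)
    also have "\<dots> = \<bar>(f x - f y) $ i\<bar>" by (simp add: f_def)
    also have "\<dots> \<le> norm (f x - f y)" by (rule component_le_norm_cart)
    finally have "c2 * (w n / 2) \<le> c2 * norm (f x - f y)" using c2(1) by simp
    also have "\<dots> \<le> \<nu> (f x - f y)" by (rule c2)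
    finally have "w n \<le> 2 / c2 * \<nu> (f x - f y)" using c2(1) by (simp add: field_simps)
    then have "w n powr \<theta> \<le> (2 / c2 * \<nu> (f x - f y)) powr \<theta>"
      using w_pos[of n] \<theta> by (intro powr_mono2) auto
    also have "\<dots> = (2 / c2) powr \<theta> * \<nu> (f x - f y) powr \<theta>"
      by (rule powr_mult)
    finally have "C * w n powr \<theta> \<le> B * \<nu> (f x - f y) powr \<theta>"
      using C by (simp add: B_def)
    with dist_le[OF xy(1,2) eq neq] 1 show ?thesis by linarith
  qed
  have zero: "\<nu> 0 = 0" using \<nu> unfolding is_norm_def by blast
  have inj: "inj_on f X"
  proof (rule inj_onI, rule ccontr)
    fix x y assume xy: "x \<in> X" "y \<in> X" "f x = f y" "x \<noteq> y"
    \<comment> \<open>Here \<open>0 powr \<theta> = 0\<close>, so the second estimate gives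
      injectivity.\<close>
    then have "dist x y \<le> 0" using main[of x y] zero by simp
    with xy show False by simp
  qed
  have 1: "holder_on dist (norm_dist \<nu>) \<theta> X f"
    unfolding holder_on_def norm_dist_def
  proof (intro conjI exI[of _ A] ballI)
    fix x y assume "x \<in> X" "y \<in> X"
    then show "\<nu> (f x - f y) \<le> A * dist x y powr \<theta>" using main[of x y] zero by (cases "x = y") auto
  qed (use \<theta> AB in auto)
  have 2: "holder_on (norm_dist \<nu>) dist \<theta> (f ` X) (inv_into X f)"
    unfolding holder_on_def norm_dist_def
  proof (intro conjI exI[of _ B] ballI)
    fix u v assume "u \<in> f ` X" "v \<in> f ` X"
    then obtain x y where "x \<in> X" "y \<in> X" "u = f x" "v = f y" by blast
    then show "dist (inv_into X f u) (inv_into X f v) \<le> B * \<nu> (u - v) powr \<theta>"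
      using main[of x y] inj zero by (cases "x = y") auto
  qed (use \<theta> AB in auto)
  show ?thesis
    using 1 2 inj unfolding bi_holder_embedding_def by blast
qed

section \<open>Counting grid points, and bounding gaps by diameters\<close>

text \<open>Here \<open>u\<close> and \<open>v\<close> stand for consecutive diameters. With
  \<open>x = - ln u\<close> and \<open>y = - ln v\<close> the counting claim follows from
  \<open>(N - D * R) * y >= (N - D) * x + N * ln 8\<close>. The worst case is
  \<open>y = (1 + s) * x\<close>, where the hypothesis on \<open>N\<close> leaves the surplus
  \<open>\<kappa> * x\<close>.\<close>

lemma grid_capacity:
  fixes s D R t0 :: real and N :: nat
  assumes s: "s > 0" and D: "D \<ge> 0" and R: "R \<ge> 1" and N: "real N * s > D * ((1 + s) * R - 1)"
  obtains u0 where "u0 > 0"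
    "\<And>u v. 0 < u \<Longrightarrow> u < u0 \<Longrightarrow> 0 < v \<Longrightarrow> v \<le> u powr (1 + s) \<Longrightarrow>
       8 * v \<le> u \<and> t0 < u / v powr R \<and>
       (u / v powr R) powr D \<le> real (nat \<lfloor>u / (4 * v)\<rfloor> ^ N)"
proof -
  define \<kappa> where "\<kappa> = real N * s - D * ((1 + s) * R - 1)"
  have \<kappa>: "\<kappa> > 0" using N by (simp add: \<kappa>_def)
  define t where "t = max 8 (t0 + 1)"
  \<comment> \<open>For \<open>x > M\<close> the first entry lets the surplus absorb
    \<open>N * ln 8\<close>, and the second forces \<open>u / v >= t\<close>.\<close>
  define M where "M = max (real N * ln 8 / \<kappa>) (ln t / s)"
  have t: "t \<ge> 8" "t > t0" by (auto simp: t_def)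
  have "8 * v \<le> u \<and> t0 < u / v powr R \<and>
       (u / v powr R) powr D \<le> real (nat \<lfloor>u / (4 * v)\<rfloor> ^ N)"
    if u: "0 < u" "u < min 1 (exp (- M))" and v: "0 < v" "v \<le> u powr (1 + s)" for u v
  proof -
    define x where "x = - ln u"
    define y where "y = - ln v"
    have "ln u < - M" using u by (metis exp_gt_zero ln_exp ln_less_cancel_iff min_less_iff_conj)
    then have x: "x > M" by (simp add: x_def)
    have "ln v \<le> ln (u powr (1 + s))" using u v by (subst ln_le_cancel_iff) auto
    then have y: "y \<ge> (1 + s) * x" using u by (simp add: x_def y_def ln_powr)
    have xs: "ln t \<le> s * x" using x s by (simp add: M_def field_simps)
    have x\<kappa>: "real N * ln 8 \<le> \<kappa> * x" using x \<kappa> by (simp add: M_def field_simps)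
    have "ln t \<le> ln (u / v)" using xs y u v by (simp add: ln_div x_def y_def algebra_simps)
    then have tuv: "t \<le> u / v" using u v t by (subst (asm) ln_le_cancel_iff) auto
    then have "t * v \<le> u" using v by (simp add: field_simps)
    moreover have "8 * v \<le> t * v" using t v by simp
    ultimately have 8: "8 * v \<le> u" by linarith
    with u v have "v \<le> 1" by simp
    then have "v powr R \<le> v" using powr_mono'[of 1 R v] R v by simp
    then have "u / v \<le> u / v powr R" using u v by (intro divide_left_mono) auto
    with tuv t have ratio: "t0 < u / v powr R" by linarith
    \<comment> \<open>The coefficient of \<open>y\<close> must be positive for
      \<open>y = (1 + s) * x\<close> to be the worst case.\<close>
    define A where "A = real N - D * R"
    have "s * A = \<kappa> + D * (R - 1)" by (simp add: A_def \<kappa>_def algebra_simps)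
    moreover have "D * (R - 1) \<ge> 0" using D R by simp
    ultimately have "s * A > 0" using \<kappa> by linarith
    then have "A > 0" using s by (simp add: zero_less_mult_iff)
    then have "A * y \<ge> A * ((1 + s) * x)" using y by simp
    also have "A * ((1 + s) * x) = (real N - D) * x + \<kappa> * x" by (simp add: A_def \<kappa>_def algebra_simps)
    finally have "D * (R * y - x) \<le> real N * (y - x - ln 8)"
      using x\<kappa> by (simp add: A_def algebra_simps)
    then have "D * ln (u / v powr R) \<le> real N * ln (u / (8 * v))"
      using u v by (simp add: ln_div ln_mult ln_powr x_def y_def algebra_simps)
    then have "ln ((u / v powr R) powr D) \<le> ln ((u / (8 * v)) ^ N)"
      using u v by (simp add: ln_powr ln_realpow)
    then have "(u / v powr R) powr D \<le> (u / (8 * v)) ^ N"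
      using u v by (subst (asm) ln_le_cancel_iff) auto
    also have "\<dots> \<le> real (nat \<lfloor>u / (4 * v)\<rfloor>) ^ N"
    proof (rule power_mono)
      \<comment> \<open>Rounding down a number that is at least 2 loses at most half of it; this is
        why 8 replaces 4.\<close>
      have "u / (4 * v) = 2 * (u / (8 * v))" by simp
      moreover have "1 \<le> u / (8 * v)" using 8 v by simp
      ultimately show "u / (8 * v) \<le> real (nat \<lfloor>u / (4 * v)\<rfloor>)" by linarith
    qed (use u v in simp)
    finally show ?thesis using 8 ratio by simp
  qed
  then show thesis by (intro that[of "min 1 (exp (- M))"]) auto
qed

text \<open>A ratio above 1 rules out diameter 0 and, since \<open>ln 0 = 0\<close>, gap 0; a finite
  ratio rules out the infinite default. As \<open>ln (part_diam \<alpha>)\<close> is negative,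
  clearing the denominator reverses the inequality.\<close>

lemma part_gap_ge_powr:
  assumes "bounded X" "{} \<notin> \<alpha>" "part_diam \<alpha> \<ge> 0"
    and ratio: "1 < part_log_ratio X \<alpha>" "part_log_ratio X \<alpha> < ereal R"
  shows "part_diam \<alpha> > 0" "part_diam \<alpha> powr R \<le> part_gap X \<alpha>"
proof -
  have \<delta>: "part_diam \<alpha> \<noteq> 0" using ratio(1) by (auto simp: part_log_ratio_def)
  with assms(3) show pos: "part_diam \<alpha> > 0" by simp
  have lt: "part_diam \<alpha> < 1" and eq: "part_log_ratio X \<alpha> = ereal (ln (part_gap X \<alpha>) / ln (part_diam \<alpha>))"
    using ratio(2) \<delta> by (auto simp: part_log_ratio_def split: if_splits)
  have "part_gap X \<alpha> \<noteq> 0" using ratio(1) unfolding eq by (auto simp: one_ereal_def)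
  with part_gap_nonneg[OF assms(1,2)] have gap: "part_gap X \<alpha> > 0" by (simp add: less_le)
  have "ln (part_diam \<alpha>) < 0" using pos lt by simp
  moreover have "ln (part_gap X \<alpha>) / ln (part_diam \<alpha>) < R" using ratio(2) eq by simp
  ultimately have "ln (part_gap X \<alpha>) > R * ln (part_diam \<alpha>)" by (simp add: divide_less_eq)
  also have "R * ln (part_diam \<alpha>) = ln (part_diam \<alpha> powr R)" using pos by (simp add: ln_powr)
  finally show "part_diam \<alpha> powr R \<le> part_gap X \<alpha>"
    using gap pos by (subst (asm) ln_less_cancel_iff) auto
qed

section \<open>Construction of the embedding\<close>

theorem theorem4p2:
  fixes X :: "'a::metric_space set"
    and D R p s \<epsilon> :: real
    and \<alpha> :: "nat \<Rightarrow> 'a set set"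
    and \<nu> :: "real ^ 'n \<Rightarrow> real"
  assumes "compact X" and "diameter X \<le> 1"
    and "assouad_dim X = ereal D"
    and "log_ratio X = ereal R" and "1 < R"
    and "1 < p" and "0 < s" and "s \<le> p - 1"
    and "\<alpha> \<in> A_star p X"
    and "\<forall>n\<ge>1. part_diam (\<alpha> (Suc n)) \<le> part_diam (\<alpha> n) powr (1 + s)"
    and "real CARD('n) > (D + R - 1) * ((1 + s) * (2 * R - 1) - 1) / s"
    and "0 < \<epsilon>" and "\<epsilon> < min 1 (R - 1)"
    and "is_norm \<nu>"
  shows "\<exists>f :: 'a \<Rightarrow> real ^ 'n.
           bi_holder_embedding dist (norm_dist \<nu>) X f \<and>
           holder_on dist (norm_dist \<nu>) (1 / (p * (R + \<epsilon>))) X f \<and>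
           holder_on (norm_dist \<nu>) dist (1 / (p * (R + \<epsilon>))) (f ` X) (inv_into X f)"
proof -
  define R' where "R' = R + \<epsilon>"
  \<comment> \<open>The strict slack in \<open>D' > D\<close> and \<open>R' > R\<close> is paid for by the excess of the assumed bound on \<open>N\<close>.\<close>
  define D' where "D' = max 0 (D + R - 1)"
  define \<theta> where "\<theta> = 1 / (p * R')"
  define \<delta> where "\<delta> n = part_diam (\<alpha> n)" for n
  have R': "R' > R" "R' > 1" "R' < 2 * R - 1" using assms(5,12,13) by (auto simp: R'_def)
  \<comment> \<open>The first identity turns the gap bound into a power \<open>1 / p\<close>; the
    second compares a diameter with its power \<open>p * \<theta>\<close>, an exponent below
    1.\<close>
  have \<theta>: "\<theta> > 0" "\<theta> * R' = 1 / p" "p * \<theta> = 1 / R'" using R' assms(6) by (auto simp: \<theta>_def)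
  have "D' * ((1 + s) * R' - 1) < real CARD('n) * s"
  proof (cases "D + R - 1 \<ge> 0")
    case True
    have "(1 + s) * R' - 1 \<le> (1 + s) * (2 * R - 1) - 1" using R' assms(7) by simp
    then have "D' * ((1 + s) * R' - 1) \<le> (D + R - 1) * ((1 + s) * (2 * R - 1) - 1)"
      using True by (simp add: D'_def mult_left_mono)
    also have "\<dots> < real CARD('n) * s" using assms(7,11) by (simp add: pos_divide_less_eq)
    finally show ?thesis .
  qed (use assms(7) in \<open>simp add: D'_def\<close>)
  moreover have "D' \<ge> 0" "D < D'" using assms(5) by (auto simp: D'_def)
  ultimately have D': "D' \<ge> 0" "D < D'" "real CARD('n) * s > D' * ((1 + s) * R' - 1)" by auto
  have X: "bounded X" using assms(1) by (rule compact_imp_bounded)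
  have part: "clopen_partition X (\<alpha> n)" if "n \<ge> 1" for n
    using assms(9) that by (auto simp: A_star_def)
  obtain a where a: "a > 0" "\<And>n. n \<ge> 1 \<Longrightarrow> a * \<delta> n powr p \<le> \<delta> (Suc n)"
    using assms(9) by (auto simp: A_star_def \<delta>_def)
  obtain r0 t0 where r0: "r0 > 0" and sep: "\<And>r1 r2. 0 < r2 \<Longrightarrow> r2 < r1 \<Longrightarrow> r1 < r0 \<Longrightarrow> r1 / r2 > t0 \<Longrightarrow>
       real (sep_number X r1 r2) \<le> max 1 ((r1 / r2) powr D')"
    using sep_number_le_powr[of X D'] assms(3) D' by auto
  obtain u0 where u0: "u0 > 0" and cap: "\<And>u v. 0 < u \<Longrightarrow> u < u0 \<Longrightarrow> 0 < v \<Longrightarrow> v \<le> u powr (1 + s) \<Longrightarrow>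
       8 * v \<le> u \<and> t0 < u / v powr R' \<and>
       (u / v powr R') powr D' \<le> real (nat \<lfloor>u / (4 * v)\<rfloor> ^ CARD('n))"
    using grid_capacity[OF assms(7) D'(1) _ D'(3), of t0] R' by auto
  have \<delta>_lim: "\<delta> \<longlonglongrightarrow> 0" using assms(9) by (simp add: A_star_def \<delta>_def [abs_def])
  have L_lim: "(\<lambda>n. part_log_ratio X (\<alpha> n)) \<longlonglongrightarrow> ereal R"
    using assms(4,9) by (simp add: A_star_def)
  \<comment> \<open>From \<open>n0\<close> on, the dimension, capacity and ratio bounds all apply;
    \<open>n >= 1\<close> is demanded because index 0 of the sequence is unconstrained.\<close>
  have "\<forall>\<^sub>F n in sequentially. n \<ge> 1 \<and> \<delta> n < min 1 (min r0 u0) \<and>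
          1 < part_log_ratio X (\<alpha> n) \<and> part_log_ratio X (\<alpha> n) < ereal R'"
    using r0 u0 R' assms(5)
    by (intro eventually_conj eventually_ge_at_top order_tendstoD[OF \<delta>_lim] order_tendstoD[OF L_lim])
      (auto simp: one_ereal_def)
  then obtain n0 where n0: "\<And>n. n \<ge> n0 \<Longrightarrow> n \<ge> 1 \<and> \<delta> n < min 1 (min r0 u0) \<and>
          1 < part_log_ratio X (\<alpha> n) \<and> part_log_ratio X (\<alpha> n) < ereal R'"
    by (auto simp: eventually_sequentially)
  define w where "w n = \<delta> (n0 + n)" for n
  define \<beta> where "\<beta> n = \<alpha> (n0 + n)" for n
  define q where "q n = part_of (\<beta> n)" for n
  \<comment> \<open>Level 0 has no parent, so it gets one digit for each part. At later levels
    \<open>K\<close> counts the steps of length \<open>4 * w (Suc m)\<close> that fit into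
    \<open>w m\<close>, as \<open>base_le\<close> demands.\<close>
  define K where "K n = (case n of 0 \<Rightarrow> card (\<beta> 0) | Suc m \<Rightarrow> nat \<lfloor>w m / (4 * w (Suc m))\<rfloor>)" for n
  have \<beta>: "clopen_partition X (\<beta> n)" for n unfolding \<beta>_def using n0[of "n0 + n"] by (intro part) simp
  then have \<beta>': "partition_on X (\<beta> n)" "finite (\<beta> n)" "{} \<notin> \<beta> n" for n
    unfolding clopen_partition_def partition_on_def by auto
  have w_diam: "w n = part_diam (\<beta> n)" for n by (simp add: w_def \<delta>_def \<beta>_def)
  have w_pos: "w n > 0" and gap: "w n powr R' \<le> part_gap X (\<beta> n)" for n
    using part_gap_ge_powr[of X "\<beta> n" R', OF X] n0[of "n0 + n"] \<beta>'[of n] part_diam_nonneg[OF X \<beta>[of n]]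
    by (auto simp: w_diam \<beta>_def)
  have w_less: "w n < 1" "w n < r0" "w n < u0" for n using n0[of "n0 + n"] by (auto simp: w_def)
  have w_Suc: "w (Suc n) \<le> w n powr (1 + s)" for n
    using assms(10) n0[of "n0 + n"] by (simp add: w_def \<delta>_def)
  have w_ge: "a * w n powr p \<le> w (Suc n)" for n
    using a(2)[of "n0 + n"] n0[of "n0 + n"] by (simp add: w_def)
  note cap = cap[OF w_pos w_less(3) w_pos w_Suc]
  \<comment> \<open>The empty partition has diameter 0 by convention.\<close>
  have "\<beta> 0 \<noteq> {}" using w_pos[of 0] by (auto simp: w_diam part_diam_def)
  then have K0: "K 0 > 0" using \<beta>'(2)[of 0] by (simp add: K_def card_gt_0_iff)
  have K_Suc: "K (Suc n) > 0" "real (K (Suc n)) * w (Suc n) \<le> w n / 4" for n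
  proof -
    have z: "w n / (4 * w (Suc n)) \<ge> 1" using cap[of n] w_pos[of "Suc n"] by simp
    then show "K (Suc n) > 0" by (simp add: K_def)
    have "real (K (Suc n)) \<le> w n / (4 * w (Suc n))" using z by (simp add: K_def)
    then show "real (K (Suc n)) * w (Suc n) \<le> w n / 4"
      using w_pos[of "Suc n"] by (simp add: field_simps)
  qed
  have K_pos: "K n > 0" for n using K0 K_Suc by (cases n) auto
  have same: "dist x y \<le> w n" if "x \<in> X" "y \<in> X" "q n x = q n y" for n x y
    unfolding w_diam using X \<beta>
  proof (rule dist_le_part_diam)
    show "part_of (\<beta> n) x \<in> \<beta> n" "x \<in> part_of (\<beta> n) x" "y \<in> part_of (\<beta> n) x"
      using part_of[OF \<beta>'(1)[of n]] that unfolding q_def by metis+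
  qed
  have diff: "w n powr R' \<le> dist x y" if "x \<in> X" "y \<in> X" "q n x \<noteq> q n y" for n x y
  proof -
    have "part_gap X (\<beta> n) \<le> dist x y"
      using part_of[OF \<beta>'(1)[of n]] \<beta>'(2) that unfolding q_def by (intro part_gap_le_dist)
    with gap[of n] show ?thesis by linarith
  qed
  have q_fin: "finite (q n ` {y \<in> X. \<forall>m<n. q m y = q m x})" for n x
    using part_of(1)[OF \<beta>'(1)[of n]] \<beta>'(2)[of n] unfolding q_def
    by (elim finite_subset[rotated]) auto
  have q_card: "card (q n ` {y \<in> X. \<forall>m<n. q m y = q m x}) \<le> K n ^ CARD('n)" if "x \<in> X" for n x
  proof (cases n)
    case 0
    have "card (q 0 ` X) \<le> card (\<beta> 0)"
      using part_of(1)[OF \<beta>'(1)[of 0]] \<beta>'(2)[of 0] unfolding q_def by (intro card_mono) auto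
    also have "\<dots> \<le> K 0 ^ CARD('n)" using self_le_power[of "K 0" "CARD('n)"] K0 by (simp add: K_def)
    finally show ?thesis using 0 by simp
  next
    case (Suc m)
    \<comment> \<open>Of the agreement below \<open>n\<close> only level \<open>m\<close> is used:
      it places all competing points in one ball of radius \<open>w m\<close> around
      \<open>x\<close>.\<close>
    have "{y \<in> X. \<forall>m<n. q m y = q m x} \<subseteq> cball x (w m) \<inter> X"
      using same[of x _ m] that Suc by auto
    then have "card (q n ` {y \<in> X. \<forall>m<n. q m y = q m x}) \<le> sep_number X (w m) (w n powr R')"
      unfolding q_def[of n] using assms(1) \<beta>' gap w_pos[of n] that
      by (intro card_parts_le_sep_number) (auto simp: less_le)
    moreover have "real (sep_number X (w m) (w n powr R')) \<le> real (K n ^ CARD('n))"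
    proof -
      have "w n powr R' \<le> w n powr 1"
        using w_pos[of n] w_less(1)[of n] R' by (intro powr_mono') auto
      then have "w n powr R' < w m" using cap[of m] Suc w_pos[of n] by simp
      then have "real (sep_number X (w m) (w n powr R')) \<le> max 1 ((w m / w n powr R') powr D')"
        using w_pos w_less cap[of m] Suc by (intro sep) (auto simp: less_le)
      also have "\<dots> \<le> real (K n ^ CARD('n))"
        using cap[of m] Suc K_pos[of n] by (simp add: K_def)
      finally show ?thesis .
    qed
    ultimately show ?thesis by linarith
  qed
  \<comment> \<open>The terms with \<open>w 0\<close> serve level 0 and those with \<open>a\<close>
    the later levels, one for each of the two estimates; the entry 1 makes \<open>C\<close>
    positive.\<close>
  define C where "C = max (max 1 (1 / w 0 powr \<theta>))
    (max (real (K 0) * w 0 / w 0 powr (1 / p)) (max (1 / a powr (1 / p)) (1 / a powr \<theta>)))"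
  have C: "C \<ge> 1" "C \<ge> 1 / w 0 powr \<theta>" "C \<ge> real (K 0) * w 0 / w 0 powr (1 / p)"
    "C \<ge> 1 / a powr (1 / p)" "C \<ge> 1 / a powr \<theta>" by (auto simp: C_def)
  have "\<exists>f :: 'a \<Rightarrow> real ^ 'n.
           bi_holder_embedding dist (norm_dist \<nu>) X f \<and>
           holder_on dist (norm_dist \<nu>) \<theta> X f \<and>
           holder_on (norm_dist \<nu>) dist \<theta> (f ` X) (inv_into X f)"
  proof (rule bi_holder_from_labels[of w K \<nu> \<theta> C X q])
    show "positional_system w K" by unfold_locales (rule w_pos K_pos K_Suc(2))+
    show "\<exists>n. q n x \<noteq> q n y" if "x \<in> X" "y \<in> X" "x \<noteq> y" for x y
    proof (rule ccontr)
      assume "\<not> ?thesis"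
      then have "dist x y \<le> w n" for n using same[OF that(1,2)] by blast
      moreover have "w \<longlonglongrightarrow> 0"
        using LIMSEQ_ignore_initial_segment[OF \<delta>_lim, of n0] by (simp add: w_def[abs_def] add.commute)
      ultimately have "dist x y \<le> 0" by (intro LIMSEQ_le_const) auto
      with that show False by simp
    qed
    fix n x y assume xy: "x \<in> X" "y \<in> X" and eq: "\<forall>m<n. q m x = q m y" and neq: "q n x \<noteq> q n y"
    have "(w n powr R') powr \<theta> \<le> dist x y powr \<theta>"
      using diff[OF xy neq] \<theta> by (intro powr_mono2) auto
    then have d: "w n powr (1 / p) \<le> dist x y powr \<theta>" using \<theta> by (simp add: powr_powr mult.commute)
    show "real (K n) * w n \<le> C * dist x y powr \<theta>"
    proof (cases n)
      case 0
      have "real (K 0) * w 0 = real (K 0) * w 0 / w 0 powr (1 / p) * w 0 powr (1 / p)"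
        using w_pos[of 0] by simp
      also have "\<dots> \<le> C * dist x y powr \<theta>" using C d 0 by (intro mult_mono) auto
      finally show ?thesis using 0 by simp
    next
      case (Suc m)
      \<comment> \<open>The lower growth bound recovers the parent diameter \<open>w m\<close> from
        \<open>w n\<close>, and \<open>w m\<close> dominates the span
        \<open>K n * w n\<close>.\<close>
      have "a powr (1 / p) * w m = (a * w m powr p) powr (1 / p)"
        using a(1) w_pos[of m] assms(6) by (simp add: powr_mult powr_powr)
      also have "\<dots> \<le> w n powr (1 / p)"
        using w_ge[of m] Suc a(1) w_pos[of m] assms(6) by (intro powr_mono2) auto
      also note d
      finally have "w m \<le> 1 / a powr (1 / p) * dist x y powr \<theta>" using a(1) by (simp add: field_simps)
      also have "\<dots> \<le> C * dist x y powr \<theta>" using C by (intro mult_right_mono) auto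
      finally show ?thesis using K_Suc(2)[of m] w_pos[of m] Suc by simp
    qed
    show "dist x y \<le> C * w n powr \<theta>"
    proof (cases n)
      case 0
      have "dist x y \<le> 1" using diameter_bounded_bound[OF X xy] assms(2) by linarith
      also have "\<dots> = 1 / w 0 powr \<theta> * w 0 powr \<theta>" using w_pos[of 0] by simp
      also have "\<dots> \<le> C * w 0 powr \<theta>" using C by (intro mult_right_mono) auto
      finally show ?thesis using 0 by simp
    next
      case (Suc m)
      have "dist x y \<le> w m" using same[OF xy] eq Suc by simp
      also have "\<dots> = w m powr 1" using w_pos[of m] by simp
      \<comment> \<open>As \<open>w m < 1\<close>, lowering the exponent to \<open>1 / R'\<close>
        increases the power; then \<open>w_ge\<close> passes from \<open>w m powr p\<close> to
        \<open>w n\<close>.\<close>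
      also have "\<dots> \<le> w m powr (p * \<theta>)"
        unfolding \<theta> using w_pos[of m] w_less(1)[of m] R' by (intro powr_mono') auto
      also have "\<dots> = 1 / a powr \<theta> * (a * w m powr p) powr \<theta>"
        using a(1) by (simp add: powr_mult powr_powr)
      also have "\<dots> \<le> C * w n powr \<theta>"
        using C w_ge[of m] Suc a(1) \<theta> by (intro mult_mono powr_mono2) auto
      finally show ?thesis .
    qed
  qed (use q_fin q_card assms(14) \<theta> C in auto)
  then show ?thesis by (simp add: \<theta>_def R'_def)
qed

end
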